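(* Let $X$ be a complex manifold of complex dimension $n\ge 3$ which is Hodge-Riemann balanced, i.e. which admits a balanced metric of Hodge-Riemann type. Then $X$ admits an $(n-2)$-Kähler structure. In particular, if $n=3$, then $X$ is Kähler.
   Context: Let $X$ be a complex manifold of complex dimension $n\ge 3$; $\Lambda^{p,q}$ denotes $(p,q)$-forms (smooth, complex-valued). Hermitian metrics are identified with their fundamental (positive) $(1,1)$-forms. A Hermitian metric $F$ is balanced if $dF^{n-1}=0$. For a real $(n-2,n-2)$-form $\Omega$ and $p+q=2$, let $Q_\Omega^{p,q}(\alpha,\beta)=-\,i^{p-q}\star(\alpha\wedge\bar\beta\wedge\Omega)$ for $\alpha,\beta\in\Lambda^{p,q}$ (pointwise), where $\star$ is the Hodge star of a fixed auxiliary Hermitian metric (only the sign matters for positivity). Given a Hermitian metric $\omega$, put $P^{p,q}=\{\alpha\in\Lambda^{p,q}:\alpha\wedge\omega\wedge\Omega=0\}$. $\Omega$ is a Hodge-Riemann form with respect to $\omega$ for degree $(p,q)$ if, at every point, $Q_\Omega^{p,q}$ is positive definite on $P^{p,q}$ and there is a $Q_\Omega^{p,q}$-orthogonal decomposition $\Lambda^{p,q}=\omega\wedge\Lambda^{p-1,q-1}\oplus P^{p,q}$ (with $\Lambda^{p-1,q-1}=0$ if $pq=0$). A balanced metric $F$ is of Hodge-Riemann type if there exist a Hermitian metric $\omega$ and a real $(n-2,n-2)$-form $\Omega$ such that $\frac{F^{n-1}}{(n-1)!}=\omega\wedge\Omega$, $\Omega$ is a Hodge-Riemann form with respect to $\omega$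 for all degrees $(p,q)$ with $p+q=2$, and $\Omega$ and $\omega\wedge\Omega$ are closed. For $1\le p\le n$, a $p$-Kähler structure on $X$ is a $d$-closed, pointwise transverse $(p,p)$-form $\Theta$; transverse means that $i^{(n-p)^2}\,\Theta\wedge\psi\wedge\bar\psi$ is a positive volume form for every nonzero decomposable $\psi\in\Lambda^{n-p,0}$ at every point. *)

theory Defs
  imports "HOL-Analysis.Analysis"
begin

section \<open>Complex manifolds\<close>

text \<open>A manifold of complex dimension \<open>CARD('n)\<close> is a topological space \<open>X\<close> with a
  holomorphic atlas \<open>A\<close>. Connectedness is not required. A chart is a pair of its domain and its
  coordinate map; the values of the map outside the domain are irrelevant.\<close>

type_synonym ('m, 'n) chart = "'m set \<times> ('m \<Rightarrow> complex^'n)"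

definition chart_image :: "('m, 'n::finite) chart \<Rightarrow> (complex^'n) set" where
  "chart_image c = snd c ` fst c"

definition transition :: "('m, 'n::finite) chart \<Rightarrow> ('m, 'n) chart \<Rightarrow> complex^'n \<Rightarrow> complex^'n" where
  "transition c c' = snd c' \<circ> inv_into (fst c) (snd c)"

definition holomorphic_map_on :: "(complex^'n \<Rightarrow> complex^'n::finite) \<Rightarrow> (complex^'n) set \<Rightarrow> bool" where
  "holomorphic_map_on f S \<longleftrightarrow>
     (\<forall>z\<in>S. \<exists>f'. (f has_derivative f') (at z) \<and> Vector_Spaces.linear (*s) (*s) f')"

definition is_chart :: "'m topology \<Rightarrow> ('m, 'n::finite) chart \<Rightarrow> bool" where
  "is_chart X c \<longleftrightarrow> openin X (fst c) \<and> open (chart_image c) \<and>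
     homeomorphic_map (subtopology X (fst c)) (top_of_set (chart_image c)) (snd c)"

definition complex_manifold :: "'m topology \<Rightarrow> ('m, 'n::finite) chart set \<Rightarrow> bool" where
  "complex_manifold X A \<longleftrightarrow>
     Hausdorff_space X \<and> second_countable X \<and>
     (\<forall>c\<in>A. is_chart X c) \<and> (\<Union>c\<in>A. fst c) = topspace X \<and>
     (\<forall>c\<in>A. \<forall>c'\<in>A. holomorphic_map_on (transition c c') (snd c ` (fst c \<inter> fst c')))"


section \<open>Exterior algebra of a complex vector space\<close>

text \<open>A complex-valued form of degree \<open>k\<close> at a point is an alternating real-multilinear function of
  lists of \<open>k\<close> real tangent vectors, which are elements of \<open>complex^'n\<close>. It is extended by zero to
  lists of other lengths. So the products below need no degree arguments.\<close>

type_synonym 'n kform = "(complex^'n) list \<Rightarrow> complex"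

definition alternating_form :: "nat \<Rightarrow> 'n::finite kform \<Rightarrow> bool" where
  "alternating_form k \<alpha> \<longleftrightarrow>
     (\<forall>vs. length vs \<noteq> k \<longrightarrow> \<alpha> vs = 0) \<and>
     (\<forall>vs i. length vs = k \<and> i < k \<longrightarrow> linear (\<lambda>v. \<alpha> (vs[i := v]))) \<and>
     (\<forall>vs. length vs = k \<and> \<not> distinct vs \<longrightarrow> \<alpha> vs = 0)"

text \<open>The wedge product is the sum over all \<open>(k, l)\<close>-shuffles, a shuffle being given by the set
  \<open>I\<close> of positions passed to the first factor. Its sign is \<open>-1\<close> to the number of inversions. With
  this normalization, the product of covectors \<open>a\<close> and \<open>b\<close> maps \<open>[v, w]\<close> to
  \<open>a v * b w - a w * b v\<close>.\<close>

definition shuffle_sign :: "nat \<Rightarrow> nat set \<Rightarrow> complex" where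
  "shuffle_sign m I = (-1) ^ card {(i, j). i < j \<and> j < m \<and> i \<notin> I \<and> j \<in> I}"

definition wedge :: "'n::finite kform \<Rightarrow> 'n kform \<Rightarrow> 'n kform" (infixr \<open>\<and>\<^sub>f\<close> 75) where
  "\<alpha> \<and>\<^sub>f \<beta> = (\<lambda>vs. \<Sum>I\<in>Pow {..<length vs}.
     shuffle_sign (length vs) I * \<alpha> (nths vs I) * \<beta> (nths vs (- I)))"

definition one_form0 :: "'n::finite kform" where
  "one_form0 vs = (if vs = [] then 1 else 0)"

definition wedge_list :: "'n::finite kform list \<Rightarrow> 'n kform" where
  "wedge_list \<alpha>s = foldr (\<and>\<^sub>f) \<alpha>s one_form0"

definition wedge_power :: "'n::finite kform \<Rightarrow> nat \<Rightarrow> 'n kform" where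
  "wedge_power \<alpha> k = wedge_list (replicate k \<alpha>)"

definition cnj_form :: "'n::finite kform \<Rightarrow> 'n kform" where
  "cnj_form \<alpha> = (\<lambda>vs. cnj (\<alpha> vs))"

definition covector :: "(complex^'n::finite \<Rightarrow> complex) \<Rightarrow> 'n kform" where
  "covector a = (\<lambda>vs. if length vs = 1 then a (hd vs) else 0)"

definition complex_functional :: "(complex^'n::finite \<Rightarrow> complex) \<Rightarrow> bool" where
  "complex_functional a \<longleftrightarrow> Vector_Spaces.linear (*s) (*) a"

text \<open>The space of \<open>(p, q)\<close>-forms at a point is the complex span of the products of \<open>p\<close> covectors
  of type \<open>(1, 0)\<close> and \<open>q\<close> covectors of type \<open>(0, 1)\<close>.\<close>

inductive_set Lambda :: "nat \<Rightarrow> nat \<Rightarrow> 'n::finite kform set" for p q :: nat where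
  monomial: "length as = p \<Longrightarrow> length bs = q \<Longrightarrow> (\<forall>a\<in>set (as @ bs). complex_functional a) \<Longrightarrow>
    wedge_list (map covector as @ map (cnj_form \<circ> covector) bs) \<in> Lambda p q"
| add: "\<alpha> \<in> Lambda p q \<Longrightarrow> \<beta> \<in> Lambda p q \<Longrightarrow> (\<lambda>vs. \<alpha> vs + \<beta> vs) \<in> Lambda p q"
| scale: "\<alpha> \<in> Lambda p q \<Longrightarrow> (\<lambda>vs. c * \<alpha> vs) \<in> Lambda p q"

definition decomposable :: "nat \<Rightarrow> 'n::finite kform set" where
  "decomposable k = {wedge_list (map covector as) | as.
     length as = k \<and> (\<forall>a\<in>set as. complex_functional a)}"

definition positive_complex :: "complex \<Rightarrow> bool" where
  "positive_complex c \<longleftrightarrow> c \<in> \<real> \<and> Re c > 0"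

text \<open>The real basis \<open>u\<^sub>1, i u\<^sub>1, \<dots>, u\<^sub>n, i u\<^sub>n\<close> obtained from a complex basis is positively oriented.\<close>

definition real_frame :: "(complex^'n::finite) list \<Rightarrow> (complex^'n) list" where
  "real_frame us = concat (map (\<lambda>u. [u, \<i> *s u]) us)"

definition complex_basis :: "(complex^'n::finite) list \<Rightarrow> bool" where
  "complex_basis us \<longleftrightarrow> length us = CARD('n) \<and> distinct us \<and> vec.independent (set us)"

definition positive_volume :: "'n::finite kform \<Rightarrow> bool" where
  "positive_volume \<eta> \<longleftrightarrow> alternating_form (2 * CARD('n)) \<eta> \<and>
     (\<forall>us. complex_basis us \<longrightarrow> positive_complex (\<eta> (real_frame us)))"


section \<open>Hodge star\<close>

text \<open>\<open>riemannian G\<close> is the real inner product with fundamental form \<open>G\<close>. The Hodge star is written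
  in a \<open>G\<close>-orthonormal, positively oriented real frame \<open>e\<close>:
  \<open>(\<star>\<beta>)(w) = (\<Sum>I. \<beta>(e\<^sub>I) * vol(e\<^sub>I, w))\<close>, where \<open>I\<close> ranges over the increasing multi-indices. The
  terms with \<open>card I + length ws \<noteq> 2 * CARD('n)\<close> vanish, since \<open>vol\<close> has degree \<open>2 * CARD('n)\<close>. The
  result does not depend on the frame.\<close>

definition riemannian :: "'n::finite kform \<Rightarrow> complex^'n \<Rightarrow> complex^'n \<Rightarrow> real" where
  "riemannian G v w = Re (G [v, \<i> *s w])"

definition unitary_basis :: "'n::finite kform \<Rightarrow> (complex^'n) list \<Rightarrow> bool" where
  "unitary_basis G us \<longleftrightarrow> length us = CARD('n) \<and>
     (let e = real_frame us in
       \<forall>i<length e. \<forall>j<length e. riemannian G (e ! i) (e ! j) = (if i = j then 1 else 0))"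

definition orthonormal_frame :: "'n::finite kform \<Rightarrow> (complex^'n) list" where
  "orthonormal_frame G = real_frame (SOME us. unitary_basis G us)"

definition volume_form :: "'n::finite kform \<Rightarrow> 'n kform" where
  "volume_form G = wedge_list
     (map (\<lambda>e. covector (\<lambda>v. complex_of_real (riemannian G e v))) (orthonormal_frame G))"

definition hodge_star :: "'n::finite kform \<Rightarrow> 'n kform \<Rightarrow> 'n kform" where
  "hodge_star G \<beta> = (\<lambda>ws. let e = orthonormal_frame G in
     \<Sum>I\<in>Pow {..<length e}. \<beta> (nths e I) * volume_form G (nths e I @ ws))"


section \<open>Hodge-Riemann forms at a point\<close>

text \<open>The Hodge star of a form of top degree is a form of degree 0. Its value is its value on the
  empty list.\<close>

definition HR_pairing ::
  "'n::finite kform \<Rightarrow> 'n kform \<Rightarrow> nat \<Rightarrow> nat \<Rightarrow> 'n kform \<Rightarrow> 'n kform \<Rightarrow> complex" where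
  "HR_pairing G \<Omega> p q \<alpha> \<beta> =
     - (\<i> powi (int p - int q)) * hodge_star G (\<alpha> \<and>\<^sub>f cnj_form \<beta> \<and>\<^sub>f \<Omega>) []"

definition primitive_forms ::
  "'n::finite kform \<Rightarrow> 'n kform \<Rightarrow> nat \<Rightarrow> nat \<Rightarrow> 'n kform set" where
  "primitive_forms \<omega> \<Omega> p q = {\<alpha> \<in> Lambda p q. \<alpha> \<and>\<^sub>f \<omega> \<and>\<^sub>f \<Omega> = (\<lambda>_. 0)}"

definition lefschetz_image :: "'n::finite kform \<Rightarrow> nat \<Rightarrow> nat \<Rightarrow> 'n kform set" where
  "lefschetz_image \<omega> p q =
     (if p = 0 \<or> q = 0 then {\<lambda>_. 0} else (\<and>\<^sub>f) \<omega> ` Lambda (p - 1) (q - 1))"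

definition HR_form_at ::
  "'n::finite kform \<Rightarrow> 'n kform \<Rightarrow> 'n kform \<Rightarrow> nat \<Rightarrow> nat \<Rightarrow> bool" where
  "HR_form_at G \<omega> \<Omega> p q \<longleftrightarrow>
     (\<forall>\<alpha>\<in>primitive_forms \<omega> \<Omega> p q. \<alpha> \<noteq> (\<lambda>_. 0) \<longrightarrow>
        positive_complex (HR_pairing G \<Omega> p q \<alpha> \<alpha>)) \<and>
     Lambda p q = {\<lambda>vs. \<beta> vs + \<gamma> vs | \<beta> \<gamma>.
        \<beta> \<in> lefschetz_image \<omega> p q \<and> \<gamma> \<in> primitive_forms \<omega> \<Omega> p q} \<and>
     lefschetz_image \<omega> p q \<inter> primitive_forms \<omega> \<Omega> p q = {\<lambda>_. 0} \<and>
     (\<forall>\<beta>\<in>lefschetz_image \<omega> p q. \<forall>\<gamma>\<in>primitive_forms \<omega> \<Omega> p q. HR_pairing G \<Omega> p q \<beta> \<gamma> = 0)"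


section \<open>Differential forms\<close>

text \<open>\<open>C_diff_on k S f\<close> says that \<open>f\<close> is \<open>k\<close> times continuously differentiable, over the reals, on
  the open set \<open>S\<close>.\<close>

primrec C_diff_on :: "nat \<Rightarrow> (complex^'n::finite) set \<Rightarrow> (complex^'n \<Rightarrow> complex) \<Rightarrow> bool" where
  "C_diff_on 0 S f \<longleftrightarrow> continuous_on S f"
| "C_diff_on (Suc k) S f \<longleftrightarrow> (\<forall>z\<in>S. f differentiable (at z)) \<and>
     (\<forall>v. C_diff_on k S (\<lambda>z. frechet_derivative f (at z) v))"

text \<open>A differential form on the manifold is a family of forms on the chart images that is
  compatible with pullback along the transition maps. Its values outside the chart images are
  irrelevant.\<close>

type_synonym ('m, 'n) form = "('m, 'n) chart \<Rightarrow> complex^'n \<Rightarrow> 'n kform"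

definition smooth_form :: "('m, 'n::finite) chart set \<Rightarrow> nat \<Rightarrow> ('m, 'n) form \<Rightarrow> bool" where
  "smooth_form A k \<alpha> \<longleftrightarrow>
     (\<forall>c\<in>A. \<forall>z\<in>chart_image c. alternating_form k (\<alpha> c z)) \<and>
     (\<forall>c\<in>A. \<forall>vs r. C_diff_on r (chart_image c) (\<lambda>z. \<alpha> c z vs)) \<and>
     (\<forall>c\<in>A. \<forall>c'\<in>A. \<forall>x\<in>fst c \<inter> fst c'. \<forall>vs.
        \<alpha> c (snd c x) vs =
        \<alpha> c' (snd c' x) (map (frechet_derivative (transition c c') (at (snd c x))) vs))"

definition pq_form :: "('m, 'n::finite) chart set \<Rightarrow> nat \<Rightarrow> nat \<Rightarrow> ('m, 'n) form \<Rightarrow> bool" where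
  "pq_form A p q \<alpha> \<longleftrightarrow> smooth_form A (p + q) \<alpha> \<and>
     (\<forall>c\<in>A. \<forall>z\<in>chart_image c. \<alpha> c z \<in> Lambda p q)"

definition real_form :: "('m, 'n::finite) chart set \<Rightarrow> ('m, 'n) form \<Rightarrow> bool" where
  "real_form A \<alpha> \<longleftrightarrow> (\<forall>c\<in>A. \<forall>z\<in>chart_image c. cnj_form (\<alpha> c z) = \<alpha> c z)"

text \<open>The usual formula for \<open>d\<close> evaluated on constant vector fields, in a chart.\<close>

definition ext_deriv :: "('m, 'n::finite) form \<Rightarrow> ('m, 'n) form" where
  "ext_deriv \<alpha> c z vs = (\<Sum>i<length vs. (-1) ^ i *
     frechet_derivative (\<lambda>y. \<alpha> c y (take i vs @ drop (Suc i) vs)) (at z) (vs ! i))"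

definition closed_form :: "('m, 'n::finite) chart set \<Rightarrow> ('m, 'n) form \<Rightarrow> bool" where
  "closed_form A \<alpha> \<longleftrightarrow> (\<forall>c\<in>A. \<forall>z\<in>chart_image c. ext_deriv \<alpha> c z = (\<lambda>_. 0))"


section \<open>Metrics and \<open>p\<close>-Kaehler structures\<close>

text \<open>A Hermitian metric is represented by its fundamental form, normalized so that
  \<open>(i/2) dz \<and> d(cnj z)\<close> is the standard metric on the complex line.\<close>

definition hermitian_metric :: "('m, 'n::finite) chart set \<Rightarrow> ('m, 'n) form \<Rightarrow> bool" where
  "hermitian_metric A F \<longleftrightarrow> pq_form A 1 1 F \<and> real_form A F \<and>
     (\<forall>c\<in>A. \<forall>z\<in>chart_image c. \<forall>v. v \<noteq> 0 \<longrightarrow> positive_complex (F c z [v, \<i> *s v]))"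

definition balanced :: "('m, 'n::finite) chart set \<Rightarrow> ('m, 'n) form \<Rightarrow> bool" where
  "balanced A F \<longleftrightarrow> hermitian_metric A F \<and>
     closed_form A (\<lambda>c z. wedge_power (F c z) (CARD('n) - 1))"

text \<open>The form \<open>g\<close> is the auxiliary metric that defines the Hodge star.\<close>

definition HR_form ::
  "('m, 'n::finite) chart set \<Rightarrow> ('m, 'n) form \<Rightarrow> ('m, 'n) form \<Rightarrow> ('m, 'n) form \<Rightarrow> nat \<Rightarrow> nat \<Rightarrow> bool"
where
  "HR_form A g \<omega> \<Omega> p q \<longleftrightarrow>
     (\<forall>c\<in>A. \<forall>z\<in>chart_image c. HR_form_at (g c z) (\<omega> c z) (\<Omega> c z) p q)"

definition HR_type :: "('m, 'n::finite) chart set \<Rightarrow> ('m, 'n) form \<Rightarrow> ('m, 'n) form \<Rightarrow> bool" where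
  "HR_type A g F \<longleftrightarrow> (\<exists>\<omega> \<Omega>.
     hermitian_metric A \<omega> \<and>
     pq_form A (CARD('n) - 2) (CARD('n) - 2) \<Omega> \<and> real_form A \<Omega> \<and>
     (\<forall>c\<in>A. \<forall>z\<in>chart_image c.
        (\<lambda>vs. wedge_power (F c z) (CARD('n) - 1) vs / fact (CARD('n) - 1)) = \<omega> c z \<and>\<^sub>f \<Omega> c z) \<and>
     (\<forall>p q. p + q = 2 \<longrightarrow> HR_form A g \<omega> \<Omega> p q) \<and>
     closed_form A \<Omega> \<and> closed_form A (\<lambda>c z. \<omega> c z \<and>\<^sub>f \<Omega> c z))"

definition HR_balanced :: "('m, 'n::finite) chart set \<Rightarrow> ('m, 'n) form \<Rightarrow> bool" where
  "HR_balanced A g \<longleftrightarrow> (\<exists>F. balanced A F \<and> HR_type A g F)"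

definition transverse :: "('m, 'n::finite) chart set \<Rightarrow> nat \<Rightarrow> ('m, 'n) form \<Rightarrow> bool" where
  "transverse A p \<Theta> \<longleftrightarrow>
     (\<forall>c\<in>A. \<forall>z\<in>chart_image c. \<forall>\<psi>\<in>decomposable (CARD('n) - p). \<psi> \<noteq> (\<lambda>_. 0) \<longrightarrow>
        positive_volume (\<lambda>vs. \<i> ^ ((CARD('n) - p)\<^sup>2) * (\<Theta> c z \<and>\<^sub>f \<psi> \<and>\<^sub>f cnj_form \<psi>) vs))"

definition p_kaehler_structure ::
  "('m, 'n::finite) chart set \<Rightarrow> nat \<Rightarrow> ('m, 'n) form \<Rightarrow> bool" where
  "p_kaehler_structure A p \<Theta> \<longleftrightarrow> 1 \<le> p \<and> p \<le> CARD('n) \<and>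
     pq_form A p p \<Theta> \<and> closed_form A \<Theta> \<and> transverse A p \<Theta>"

definition kaehler_manifold :: "('m, 'n::finite) chart set \<Rightarrow> bool" where
  "kaehler_manifold A \<longleftrightarrow> (\<exists>\<omega>. hermitian_metric A \<omega> \<and> closed_form A \<omega>)"

end

theory Submission
  imports Defs
begin

text \<open>The form \<open>\<Omega>\<close> itself is the \<open>(n - 2)\<close>-Kaehler structure. In bidegree \<open>(2, 0)\<close> there is no
  Lefschetz part, so the Hodge-Riemann condition says \<open>\<star>(\<psi> \<and> cnj \<psi> \<and> \<Omega>) > 0\<close> for every
  nonzero \<open>\<psi>\<close>, which is transversality. The star evaluates a top-degree form on one unitary
  frame. Passing to another complex basis multiplies this value by the square of the modulus of a
  complex determinant. For \<open>n = 3\<close> and a tangent vector \<open>v\<close>, the product \<open>\<psi>\<close> of two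
  independent covectors that vanish on \<open>v\<close> turns transversality into \<open>\<Omega>(v, i v) > 0\<close>, so \<open>\<Omega>\<close> is a Kaehler form.\<close>

section \<open>Interior product and the algebra of the wedge product\<close>

text \<open>The sign \<open>(-1)\<^sup>k\<close> in the antiderivation rule for a factor of degree \<open>k\<close> is absorbed into
  \<open>grade_sign\<close>, so that \<open>wedge_Cons\<close> and associativity hold without degree hypotheses.\<close>

definition grade_sign :: "'n::finite kform \<Rightarrow> 'n kform" where
  "grade_sign \<alpha> = (\<lambda>vs. (-1) ^ length vs * \<alpha> vs)"

definition contract :: "complex^'n::finite \<Rightarrow> 'n kform \<Rightarrow> 'n kform" where
  "contract v \<alpha> = (\<lambda>vs. \<alpha> (v # vs))"

lemma contract_apply: "contract v \<alpha> vs = \<alpha> (v # vs)"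
  by (simp add: contract_def)

lemma grade_sign_grade_sign [simp]: "grade_sign (grade_sign \<alpha>) = \<alpha>"
  by (simp add: grade_sign_def fun_eq_iff flip: power_add mult.assoc)

lemma contract_grade_sign: "contract v (grade_sign \<alpha>) = (\<lambda>vs. - grade_sign (contract v \<alpha>) vs)"
  by (simp add: contract_def grade_sign_def)

lemma wedge_Nil: "(\<alpha> \<and>\<^sub>f \<beta>) [] = \<alpha> [] * \<beta> []"
  by (simp add: wedge_def shuffle_sign_def)

section \<open>Inversion counts of shuffles and the recursion for the wedge product\<close>

lemma shuffle_sign_insert_0:
  "shuffle_sign (Suc m) (insert 0 (Suc ` J)) = shuffle_sign m J"
proof -
  have "{(i, j). i < j \<and> j < Suc m \<and> i \<notin> insert 0 (Suc ` J) \<and> j \<in> insert 0 (Suc ` J)}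
      = map_prod Suc Suc ` {(i, j). i < j \<and> j < m \<and> i \<notin> J \<and> j \<in> J}"
  proof (intro equalityI subsetI)
    fix p
    assume "p \<in> {(i, j). i < j \<and> j < Suc m \<and> i \<notin> insert 0 (Suc ` J) \<and> j \<in> insert 0 (Suc ` J)}"
    then obtain i b where p: "p = (i, b)" "i < b" "b < Suc m" "i \<noteq> 0" "i \<notin> Suc ` J" "b \<in> Suc ` J"
      by auto
    then obtain i' b' where "i = Suc i'" "b = Suc b'" "b' \<in> J"
      by (metis imageE old.nat.exhaust)
    with p show "p \<in> map_prod Suc Suc ` {(i, j). i < j \<and> j < m \<and> i \<notin> J \<and> j \<in> J}"
      by auto
  qed auto
  moreover have "inj (map_prod Suc Suc)" by (simp add: prod.inj_map)
  ultimately show ?thesis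
    by (simp add: shuffle_sign_def card_image inj_on_subset)
qed

text \<open>Position \<open>0\<close> now goes to the second factor and precedes every position
  given to the first, which adds \<open>card J\<close> inversions.\<close>

lemma shuffle_sign_Suc_image:
  assumes "J \<subseteq> {..<m}"
  shows "shuffle_sign (Suc m) (Suc ` J) = (-1) ^ card J * shuffle_sign m J"
proof -
  let ?S = "{(i, j). i < j \<and> j < m \<and> i \<notin> J \<and> j \<in> J}"
  have "{(i, j). i < j \<and> j < Suc m \<and> i \<notin> Suc ` J \<and> j \<in> Suc ` J}
      = Pair 0 ` Suc ` J \<union> map_prod Suc Suc ` ?S" (is "?L = _")
  proof (intro equalityI subsetI)
    fix p assume "p \<in> ?L"
    then obtain i b where p: "p = (i, Suc b)" "i < Suc b" "b < m" "i \<notin> Suc ` J" "b \<in> J" by auto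
    show "p \<in> Pair 0 ` Suc ` J \<union> map_prod Suc Suc ` ?S"
      using p by (cases i) auto
  qed (use assms in auto)
  moreover have "finite ?S"
    by (rule finite_subset[of _ "{..<m} \<times> {..<m}"]) auto
  moreover have "finite J" using assms finite_subset by blast
  moreover have "inj (map_prod Suc Suc)" by (simp add: prod.inj_map)
  moreover have "Pair 0 ` Suc ` J \<inter> map_prod Suc Suc ` ?S = {}" by auto
  ultimately show ?thesis
    by (simp add: shuffle_sign_def card_Un_disjoint card_image inj_on_subset inj_on_def power_add)
qed

lemma Pow_lessThan_Suc_split:
  "Pow {..<Suc m} = (image Suc) ` Pow {..<m} \<union> (\<lambda>J. insert 0 (Suc ` J)) ` Pow {..<m}"
proof -
  have "Pow (Suc ` {..<m}) = image Suc ` Pow {..<m}"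
    by (simp add: image_Pow_surj)
  then show ?thesis
    by (simp only: lessThan_Suc_eq_insert_0 Pow_insert image_image)
qed

text \<open>Shuffles split according to the factor that receives the first argument. This is the
  antiderivation rule for the interior product. It turns the shuffle sum into a recursion over the
  argument list, so that the laws below can be proved by list induction.\<close>

lemma wedge_Cons:
  "(\<alpha> \<and>\<^sub>f \<beta>) (v # vs) = (contract v \<alpha> \<and>\<^sub>f \<beta>) vs + (grade_sign \<alpha> \<and>\<^sub>f contract v \<beta>) vs"
proof -
  let ?m = "length vs"
  let ?t = "\<lambda>I. shuffle_sign (Suc ?m) I * \<alpha> (nths (v # vs) I) * \<beta> (nths (v # vs) (- I))"
  let ?ins = "\<lambda>J. insert 0 (Suc ` J)"
  have "(\<alpha> \<and>\<^sub>f \<beta>) (v # vs) = sum ?t (Pow {..<Suc ?m})"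
    by (simp add: wedge_def)
  also have "\<dots> = sum ?t ((image Suc) ` Pow {..<?m}) + sum ?t (?ins ` Pow {..<?m})"
    unfolding Pow_lessThan_Suc_split by (rule sum.union_disjoint) auto
  also have "sum ?t (?ins ` Pow {..<?m}) = (\<Sum>J\<in>Pow {..<?m}. ?t (?ins J))"
    by (rule sum.reindex_cong[OF _ refl refl]) (auto simp: inj_on_def)
  also have "\<dots> = (contract v \<alpha> \<and>\<^sub>f \<beta>) vs"
  proof -
    have "{j. Suc j \<in> ?ins J} = J" "{j. j \<notin> J} = - J" "{j. Suc j \<in> - ?ins J} = - J" for J by auto
    then show ?thesis
      unfolding wedge_def by (simp add: shuffle_sign_insert_0 nths_Cons contract_def)
  qed
  also have "sum ?t ((image Suc) ` Pow {..<?m}) = (\<Sum>J\<in>Pow {..<?m}. ?t (Suc ` J))"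
    by (rule sum.reindex_cong[OF _ refl refl]) (auto simp: inj_on_def)
  also have "\<dots> = (grade_sign \<alpha> \<and>\<^sub>f contract v \<beta>) vs"
    unfolding wedge_def
  proof (rule sum.cong[OF refl])
    fix J assume J: "J \<in> Pow {..<?m}"
    \<comment> \<open>The extra sign \<open>(-1) ^ card J\<close> is the one that
      \<open>grade_sign\<close> puts on an argument list of length \<open>card J\<close>.\<close>
    have "{i. i < ?m \<and> i \<in> J} = J" using J by auto
    then have "length (nths vs J) = card J" by (simp add: length_nths)
    moreover have "{j. Suc j \<in> Suc ` J} = J" "{j. Suc j \<in> - Suc ` J} = - J" by auto
    ultimately show "?t (Suc ` J) = shuffle_sign ?m J * grade_sign \<alpha> (nths vs J) * contract v \<beta> (nths vs (- J))"
      using J by (auto simp: shuffle_sign_Suc_image nths_Cons contract_def grade_sign_def)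
  qed
  finally show ?thesis by (simp add: add.commute)
qed

lemma wedge_add_left: "(\<lambda>vs. \<alpha> vs + \<alpha>' vs) \<and>\<^sub>f \<beta> = (\<lambda>vs. (\<alpha> \<and>\<^sub>f \<beta>) vs + (\<alpha>' \<and>\<^sub>f \<beta>) vs)"
  by (simp add: wedge_def algebra_simps sum.distrib)

lemma wedge_add_right: "\<alpha> \<and>\<^sub>f (\<lambda>vs. \<beta> vs + \<beta>' vs) = (\<lambda>vs. (\<alpha> \<and>\<^sub>f \<beta>) vs + (\<alpha> \<and>\<^sub>f \<beta>') vs)"
  by (simp add: wedge_def algebra_simps sum.distrib)

lemma wedge_scale_left: "(\<lambda>vs. c * \<alpha> vs) \<and>\<^sub>f \<beta> = (\<lambda>vs. c * (\<alpha> \<and>\<^sub>f \<beta>) vs)"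
  by (simp add: wedge_def sum_distrib_left mult_ac)

lemma wedge_scale_right: "\<alpha> \<and>\<^sub>f (\<lambda>vs. c * \<beta> vs) = (\<lambda>vs. c * (\<alpha> \<and>\<^sub>f \<beta>) vs)"
  by (simp add: wedge_def sum_distrib_left mult_ac)

lemma wedge_minus_left: "(\<lambda>vs. - \<alpha> vs) \<and>\<^sub>f \<beta> = (\<lambda>vs. - (\<alpha> \<and>\<^sub>f \<beta>) vs)"
  using wedge_scale_left[of "-1"] by simp

lemma wedge_minus_right: "\<alpha> \<and>\<^sub>f (\<lambda>vs. - \<beta> vs) = (\<lambda>vs. - (\<alpha> \<and>\<^sub>f \<beta>) vs)"
  using wedge_scale_right[of _ "-1"] by simp

lemma wedge_zero_left: "(\<lambda>_. 0) \<and>\<^sub>f \<beta> = (\<lambda>_. 0)"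
  by (simp add: wedge_def)

lemma wedge_zero_right: "\<alpha> \<and>\<^sub>f (\<lambda>_. 0) = (\<lambda>_. 0)"
  by (simp add: wedge_def)

lemma contract_wedge:
  "contract v (\<alpha> \<and>\<^sub>f \<beta>)
     = (\<lambda>vs. (contract v \<alpha> \<and>\<^sub>f \<beta>) vs + (grade_sign \<alpha> \<and>\<^sub>f contract v \<beta>) vs)"
  by (simp add: contract_apply fun_eq_iff wedge_Cons)

text \<open>\<open>contract\<close> anticommutes with \<open>grade_sign\<close>, so both sides obey
  the same recursion.\<close>

lemma grade_sign_wedge: "grade_sign (\<alpha> \<and>\<^sub>f \<beta>) = grade_sign \<alpha> \<and>\<^sub>f grade_sign \<beta>"
proof
  fix vs show "grade_sign (\<alpha> \<and>\<^sub>f \<beta>) vs = (grade_sign \<alpha> \<and>\<^sub>f grade_sign \<beta>) vs"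
  proof (induction vs arbitrary: \<alpha> \<beta>)
    case (Cons v vs)
    have "grade_sign (\<alpha> \<and>\<^sub>f \<beta>) (v # vs) = - grade_sign (contract v (\<alpha> \<and>\<^sub>f \<beta>)) vs"
      by (simp add: grade_sign_def contract_def)
    also have "\<dots> = - grade_sign (contract v \<alpha> \<and>\<^sub>f \<beta>) vs - grade_sign (grade_sign \<alpha> \<and>\<^sub>f contract v \<beta>) vs"
      unfolding contract_wedge by (simp add: grade_sign_def algebra_simps)
    finally show ?case
      by (simp add: Cons.IH wedge_Cons contract_grade_sign wedge_minus_left wedge_minus_right)
  qed (simp add: grade_sign_def wedge_Nil)
qed

text \<open>Both bracketings expand into the same three terms, one for each factor that can be
  contracted. The forms are arbitrary in the induction because contraction changes them.\<close>

lemma wedge_assoc: "(\<alpha> \<and>\<^sub>f \<beta>) \<and>\<^sub>f \<gamma> = \<alpha> \<and>\<^sub>f \<beta> \<and>\<^sub>f \<gamma>"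
proof
  fix vs show "((\<alpha> \<and>\<^sub>f \<beta>) \<and>\<^sub>f \<gamma>) vs = (\<alpha> \<and>\<^sub>f \<beta> \<and>\<^sub>f \<gamma>) vs"
  proof (induction vs arbitrary: \<alpha> \<beta> \<gamma>)
    case (Cons v vs)
    then show ?case
      by (simp add: wedge_Cons contract_wedge grade_sign_wedge wedge_add_left wedge_add_right)
  qed (simp add: wedge_Nil)
qed

text \<open>Even forms are central. The induction over the arguments alternates between even and odd
  forms, so both cases are proved together.\<close>

lemma wedge_commute_parity:
  "(grade_sign \<alpha> = \<alpha> \<longrightarrow> (\<alpha> \<and>\<^sub>f \<beta>) vs = (\<beta> \<and>\<^sub>f \<alpha>) vs) \<and>
   (grade_sign \<alpha> = (\<lambda>vs. - \<alpha> vs) \<longrightarrow> (\<alpha> \<and>\<^sub>f \<beta>) vs = (grade_sign \<beta> \<and>\<^sub>f \<alpha>) vs)"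
proof (induction vs arbitrary: \<alpha> \<beta>)
  case (Cons v vs)
  show ?case
  proof (intro conjI impI)
    assume even: "grade_sign \<alpha> = \<alpha>"
    have c: "contract v \<alpha> = (\<lambda>vs. - grade_sign (contract v \<alpha>) vs)"
      using contract_grade_sign[of v \<alpha>] unfolding even .
    have "grade_sign (contract v \<alpha>) vs = - contract v \<alpha> vs" for vs
      using fun_cong[OF c, of vs] by (rule iffD1[OF equation_minus_iff])
    then have "grade_sign (contract v \<alpha>) = (\<lambda>vs. - contract v \<alpha> vs)"
      by (rule ext)
    then have "(contract v \<alpha> \<and>\<^sub>f \<beta>) vs = (grade_sign \<beta> \<and>\<^sub>f contract v \<alpha>) vs"
      using Cons.IH by blast
    moreover have "(\<alpha> \<and>\<^sub>f contract v \<beta>) vs = (contract v \<beta> \<and>\<^sub>f \<alpha>) vs"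
      using even Cons.IH by blast
    ultimately show "(\<alpha> \<and>\<^sub>f \<beta>) (v # vs) = (\<beta> \<and>\<^sub>f \<alpha>) (v # vs)"
      by (simp add: wedge_Cons even)
  next
    assume odd: "grade_sign \<alpha> = (\<lambda>vs. - \<alpha> vs)"
    have c: "(\<lambda>vs. - contract v \<alpha> vs) = (\<lambda>vs. - grade_sign (contract v \<alpha>) vs)"
      using contract_grade_sign[of v \<alpha>] unfolding odd by (simp add: contract_def)
    have "grade_sign (contract v \<alpha>) = contract v \<alpha>"
      using fun_cong[OF c] by (intro ext) simp
    then have "(contract v \<alpha> \<and>\<^sub>f \<beta>) vs = (\<beta> \<and>\<^sub>f contract v \<alpha>) vs"
      using Cons.IH by blast
    moreover have "(\<alpha> \<and>\<^sub>f contract v \<beta>) vs = (grade_sign (contract v \<beta>) \<and>\<^sub>f \<alpha>) vs"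
      using odd Cons.IH by blast
    ultimately show "(\<alpha> \<and>\<^sub>f \<beta>) (v # vs) = (grade_sign \<beta> \<and>\<^sub>f \<alpha>) (v # vs)"
      by (simp add: wedge_Cons odd contract_grade_sign wedge_minus_left)
  qed
qed (auto simp: wedge_Nil grade_sign_def fun_eq_iff)

lemma wedge_commute_even: "grade_sign \<alpha> = \<alpha> \<Longrightarrow> \<alpha> \<and>\<^sub>f \<beta> = \<beta> \<and>\<^sub>f \<alpha>"
  using wedge_commute_parity by blast

section \<open>Alternating multilinear forms without a fixed degree\<close>

definition multilinear_alternating :: "'n::finite kform \<Rightarrow> bool" where
  "multilinear_alternating \<alpha> \<longleftrightarrow>
     (\<forall>us ws. linear (\<lambda>v. \<alpha> (us @ v # ws))) \<and> (\<forall>us v ws. \<alpha> (us @ v # v # ws) = 0)"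

lemma multilinear_alternatingD:
  assumes "multilinear_alternating \<alpha>"
  shows "linear (\<lambda>v. \<alpha> (us @ v # ws))" "\<alpha> (us @ v # v # ws) = 0"
  using assms by (auto simp: multilinear_alternating_def)

text \<open>Polarization: the vanishing value with \<open>v + w\<close> in both slots is
  expanded.\<close>

lemma multilinear_alternating_swap:
  assumes "multilinear_alternating \<alpha>"
  shows "\<alpha> (us @ v # w # ws) = - \<alpha> (us @ w # v # ws)"
proof -
  note lin = linear_add[OF multilinear_alternatingD(1)[OF assms]]
  have "0 = \<alpha> (us @ (v + w) # (v + w) # ws)"
    by (simp add: multilinear_alternatingD[OF assms])
  also have "\<dots> = \<alpha> (us @ v # (v + w) # ws) + \<alpha> (us @ w # (v + w) # ws)"
    by (rule lin)
  also have "\<dots> = \<alpha> (us @ v # w # ws) + \<alpha> (us @ w # v # ws)"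
    using lin[of "us @ [v]" v w ws] lin[of "us @ [w]" v w ws] multilinear_alternatingD(2)[OF assms]
    by simp
  finally show ?thesis by (simp add: eq_neg_iff_add_eq_0)
qed

text \<open>The first \<open>v\<close> is moved past \<open>xs\<close> by adjacent swaps until the
  two copies meet.\<close>

lemma multilinear_alternating_repeat:
  assumes "multilinear_alternating \<alpha>"
  shows "\<alpha> (us @ v # xs @ v # ws) = 0"
proof (induction xs arbitrary: us)
  case (Cons x xs)
  have "\<alpha> (us @ v # x # xs @ v # ws) = - \<alpha> ((us @ [x]) @ v # xs @ v # ws)"
    using multilinear_alternating_swap[OF assms, of us v x] by simp
  then show ?case using Cons.IH[of "us @ [x]"] by simp
qed (simp add: multilinear_alternatingD[OF assms])

text \<open>Arbitrary repetitions reduce to adjacent ones, and slots become splittings of the list.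
  The degree survives only as a condition on the support, which leaves a property that is stable
  under \<open>contract\<close>.\<close>

lemma alternating_form_iff:
  "alternating_form k \<alpha> \<longleftrightarrow>
     multilinear_alternating \<alpha> \<and> (\<forall>vs. length vs \<noteq> k \<longrightarrow> \<alpha> vs = 0)"
proof
  assume alt: "alternating_form k \<alpha>"
  have "linear (\<lambda>v. \<alpha> (us @ v # ws))" for us ws
  proof (cases "length us + 1 + length ws = k")
    case True
    \<comment> \<open>The entry \<open>0\<close> only holds the slot that the update then
      fills.\<close>
    then have "linear (\<lambda>v. \<alpha> ((us @ 0 # ws)[length us := v]))"
      using alt unfolding alternating_form_def
      by (metis add.assoc length_Cons length_append less_add_same_cancel1 plus_1_eq_Suc zero_less_Suc)
    then show ?thesis by simp
  next
    case False
    then have "\<alpha> (us @ v # ws) = 0" for v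
      using alt by (simp add: alternating_form_def)
    then show ?thesis by (simp add: linear_iff)
  qed
  moreover have "\<alpha> (us @ v # v # ws) = 0" for us v ws
  proof -
    have "\<not> distinct (us @ v # v # ws)" by simp
    then show ?thesis using alt unfolding alternating_form_def by blast
  qed
  ultimately show "multilinear_alternating \<alpha> \<and> (\<forall>vs. length vs \<noteq> k \<longrightarrow> \<alpha> vs = 0)"
    using alt by (simp add: multilinear_alternating_def alternating_form_def)
next
  assume *: "multilinear_alternating \<alpha> \<and> (\<forall>vs. length vs \<noteq> k \<longrightarrow> \<alpha> vs = 0)"
  have "linear (\<lambda>v. \<alpha> (vs[i := v]))" if "i < length vs" for vs i
    using that multilinear_alternatingD(1)[of \<alpha> "take i vs" "drop (Suc i) vs"] *
    by (simp add: upd_conv_take_nth_drop)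
  moreover have "\<alpha> vs = 0" if nd: "\<not> distinct vs" for vs
  proof -
    obtain xs ys zs y where "vs = xs @ [y] @ ys @ [y] @ zs"
      using not_distinct_decomp[OF nd] by blast
    then show ?thesis using multilinear_alternating_repeat[of \<alpha> xs y ys zs] * by simp
  qed
  ultimately show "alternating_form k \<alpha>"
    using * by (simp add: alternating_form_def)
qed

lemma complex_scaleR: "c *\<^sub>R (z :: complex) = complex_of_real c * z"
  by (rule scaleR_conv_of_real)

lemma vec_scaleR: "c *\<^sub>R (x :: complex^'n) = complex_of_real c *s x"
  by (simp add: vec_eq_iff complex_scaleR)

lemma multilinear_alternating_contract:
  assumes "multilinear_alternating \<alpha>"
  shows "multilinear_alternating (contract v \<alpha>)"
  unfolding multilinear_alternating_def contract_def
  using multilinear_alternatingD[OF assms, of "v # _"] by simp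

lemma multilinear_alternating_grade_sign:
  assumes "multilinear_alternating \<alpha>"
  shows "multilinear_alternating (grade_sign \<alpha>)"
  using assms
  by (auto simp: multilinear_alternating_def grade_sign_def linear_iff algebra_simps)

lemma contract_linear:
  assumes "multilinear_alternating \<alpha>"
  shows "contract (u + v) \<alpha> = (\<lambda>vs. contract u \<alpha> vs + contract v \<alpha> vs)"
    and "contract (c *\<^sub>R u) \<alpha> = (\<lambda>vs. complex_of_real c * contract u \<alpha> vs)"
  by (simp_all add: contract_def complex_scaleR
      linear_add[OF multilinear_alternatingD(1)[OF assms, of "[]"], simplified]
      linear_scale[OF multilinear_alternatingD(1)[OF assms, of "[]"], simplified])

lemma contract_contract_same:
  assumes "multilinear_alternating \<alpha>"
  shows "contract v (contract v \<alpha>) = (\<lambda>_. 0)"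
  using multilinear_alternatingD(2)[OF assms, of "[]"] by (simp add: contract_def)

text \<open>Contracting the vectors of the prefix \<open>us\<close> reduces both claims to the first
  slots, where linearity is that of \<open>contract\<close> in its vector.\<close>

lemma multilinear_alternating_wedge:
  assumes "multilinear_alternating \<alpha>" "multilinear_alternating \<beta>"
  shows "multilinear_alternating (\<alpha> \<and>\<^sub>f \<beta>)"
proof -
  have "linear (\<lambda>v. (\<alpha> \<and>\<^sub>f \<beta>) (us @ v # ws)) \<and> (\<alpha> \<and>\<^sub>f \<beta>) (us @ w # w # ws) = 0" for us w ws
    using assms
  proof (induction us arbitrary: \<alpha> \<beta>)
    case Nil
    note ls = contract_linear[OF Nil(1)] contract_linear[OF Nil(2)]
    have "linear (\<lambda>v. (\<alpha> \<and>\<^sub>f \<beta>) (v # ws))"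
      by (auto simp: linear_iff wedge_Cons ls wedge_add_left wedge_add_right wedge_scale_left
          wedge_scale_right complex_scaleR algebra_simps)
    \<comment> \<open>Two applications of \<open>wedge_Cons\<close> produce two mixed terms in which
      each factor is contracted once. They cancel because \<open>contract\<close> anticommutes with
      \<open>grade_sign\<close>.\<close>
    moreover have "(\<alpha> \<and>\<^sub>f \<beta>) (w # w # ws) = 0"
      by (simp add: wedge_Cons contract_wedge contract_grade_sign wedge_minus_left
          contract_contract_same[OF Nil(1)] contract_contract_same[OF Nil(2)] wedge_zero_left wedge_zero_right)
    ultimately show ?case by simp
  next
    case (Cons u us)
    then show ?case
      by (simp add: wedge_Cons linear_compose_add multilinear_alternating_contract
          multilinear_alternating_grade_sign)
  qed
  then show ?thesis by (simp add: multilinear_alternating_def)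
qed

lemma wedge_eq_0_if_length:
  assumes "\<And>vs. length vs \<noteq> k \<Longrightarrow> \<alpha> vs = 0" "\<And>vs. length vs \<noteq> l \<Longrightarrow> \<beta> vs = 0"
    and "length vs \<noteq> k + l"
  shows "(\<alpha> \<and>\<^sub>f \<beta>) vs = 0"
  unfolding wedge_def
proof (intro sum.neutral ballI)
  fix I assume I: "I \<in> Pow {..<length vs}"
  have "{i. i < length vs \<and> i \<in> I} \<union> {i. i < length vs \<and> i \<in> - I} = {..<length vs}" by auto
  then have "length (nths vs I) + length (nths vs (- I)) = length vs"
    unfolding length_nths by (subst card_Un_disjoint[symmetric]) auto
  then have "length (nths vs I) \<noteq> k \<or> length (nths vs (- I)) \<noteq> l"
    using assms(3) by auto
  then show "shuffle_sign (length vs) I * \<alpha> (nths vs I) * \<beta> (nths vs (- I)) = 0"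
    using assms(1,2) by auto
qed

lemma alternating_form_wedge:
  "alternating_form k \<alpha> \<Longrightarrow> alternating_form l \<beta> \<Longrightarrow> alternating_form (k + l) (\<alpha> \<and>\<^sub>f \<beta>)"
  unfolding alternating_form_iff
  by (blast intro: multilinear_alternating_wedge wedge_eq_0_if_length)

section \<open>Conjugates, covectors and products of covectors as alternating forms\<close>

lemma alternating_form_cnj:
  assumes "alternating_form k \<alpha>"
  shows "alternating_form k (cnj_form \<alpha>)"
  using assms by (auto simp: alternating_form_iff multilinear_alternating_def cnj_form_def linear_iff
      complex_cnj_scaleR)

lemma complex_functional_linear: "complex_functional a \<Longrightarrow> linear a"
proof -
  assume "complex_functional a"
  then interpret a: Vector_Spaces.linear "(*s)" "(*)" a by (simp add: complex_functional_def)
  show "linear a"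
    by (intro linearI) (simp_all add: a.add a.scale complex_scaleR vec_scaleR)
qed

lemma alternating_form_covector: "linear a \<Longrightarrow> alternating_form 1 (covector a)"
proof -
  assume a: "linear a"
  have "linear (\<lambda>v. covector a (us @ v # ws))" for us ws
  proof (cases "us = [] \<and> ws = []")
    case True
    then show ?thesis using a by (simp add: covector_def)
  next
    case False
    then show ?thesis by (auto simp: covector_def linear_iff)
  qed
  then show ?thesis
    by (auto simp: alternating_form_iff multilinear_alternating_def covector_def)
qed

lemma alternating_form_one_form0: "alternating_form 0 one_form0"
  by (auto simp: alternating_form_def one_form0_def)

lemma wedge_list_Cons: "wedge_list (\<alpha> # \<alpha>s) = \<alpha> \<and>\<^sub>f wedge_list \<alpha>s"
  by (simp add: wedge_list_def)

lemma wedge_list_Nil: "wedge_list [] = one_form0"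
  by (simp add: wedge_list_def)

lemma alternating_form_wedge_list:
  "(\<And>a. a \<in> set as \<Longrightarrow> linear a) \<Longrightarrow> alternating_form (length as) (wedge_list (map covector as))"
proof (induction as)
  case (Cons a as)
  then show ?case
    using alternating_form_wedge[OF alternating_form_covector[of a], of "length as"]
    by (simp add: wedge_list_Cons)
qed (simp add: wedge_list_Nil alternating_form_one_form0)

lemma alternating_form_decomposable:
  "\<psi> \<in> decomposable k \<Longrightarrow> alternating_form k \<psi>"
  unfolding decomposable_def
  using alternating_form_wedge_list complex_functional_linear by fastforce

lemma grade_sign_even:
  "alternating_form k \<alpha> \<Longrightarrow> even k \<Longrightarrow> grade_sign \<alpha> = \<alpha>"
  by (auto simp: alternating_form_def grade_sign_def fun_eq_iff)
     (metis even_iff_mod_2_eq_zero minus_one_power_iff mult_1 mult_zero_right)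

section \<open>Top-degree forms on complex bases\<close>

lemma real_frame_simps [simp]:
  "real_frame [] = []" "real_frame (u # us) = u # \<i> *s u # real_frame us"
  "real_frame (us @ ws) = real_frame us @ real_frame ws"
  by (simp_all add: real_frame_def)

lemma length_real_frame: "length (real_frame us) = 2 * length us"
  by (induction us) auto

lemma set_real_frame: "set (real_frame us) = set us \<union> (\<lambda>u. \<i> *s u) ` set us"
  by (induction us) auto

lemma multilinear_alternating_eq_0_if_span:
  assumes "multilinear_alternating \<alpha>" "y \<in> span (set us \<union> set ws)"
  shows "\<alpha> (us @ y # ws) = 0"
proof (rule linear_eq_0_on_span[OF multilinear_alternatingD(1)[OF assms(1)] _ assms(2)])
  fix x assume "x \<in> set us \<union> set ws"
  then consider as bs where "us = as @ x # bs" | as bs where "ws = as @ x # bs"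
    by (meson UnE split_list)
  then show "\<alpha> (us @ x # ws) = 0"
  proof cases
    case 1
    then show ?thesis using multilinear_alternating_repeat[OF assms(1), of as x bs ws] by simp
  next
    case 2
    then show ?thesis using multilinear_alternating_repeat[OF assms(1), of us x as bs] by simp
  qed
qed

text \<open>A complex multiple of \<open>x\<close> is a real combination of \<open>x\<close> and
  \<open>\<i> *s x\<close>. This converts complex dependence of vectors into real dependence of
  frames.\<close>

lemma span_real_frame:
  assumes "y \<in> vec.span (set us)"
  shows "y \<in> span (set (real_frame us))"
  using assms
proof (induction rule: vec.span_induct_alt)
  case (step c x y)
  have "c *s x = Re c *\<^sub>R x + Im c *\<^sub>R (\<i> *s x)"
    by (simp add: vec_eq_iff complex_eq_iff)
  with step show ?case
    by (auto intro!: span_add span_scale intro: span_base simp: set_real_frame)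
qed (rule span_zero)

text \<open>Multiplication by \<open>c\<close> on a complex line has real determinant
  \<open>(cmod c)\<^sup>2\<close>, and \<open>y\<close> depends on the other vectors, so it
  contributes nothing.\<close>

lemma frame_update:
  assumes alt: "multilinear_alternating \<alpha>" and y: "y \<in> vec.span (set us \<union> set ws)"
  shows "\<alpha> (real_frame (us @ (c *s u + y) # ws))
       = complex_of_real ((cmod c)\<^sup>2) * \<alpha> (real_frame (us @ u # ws))"
proof -
  let ?U = "real_frame us" and ?W = "real_frame ws"
  have fr: "set ?U \<union> set ?W = set (real_frame (us @ ws))" by simp
  have y': "y \<in> span (set ?U \<union> set ?W)" "\<i> *s y \<in> span (set ?U \<union> set ?W)"
    unfolding fr using y span_real_frame[of _ "us @ ws"] by (simp_all add: vec.span_scale)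
  \<comment> \<open>Since \<open>y\<close> and \<open>\<i> *s y\<close> depend on the remaining
    frame, each gives zero in its slot, whatever \<open>v\<close> stands in the neighbouring
    one.\<close>
  have 0: "\<alpha> (?U @ y # v # ?W) = 0" "\<alpha> (?U @ v # \<i> *s y # ?W) = 0" for v
    using multilinear_alternating_eq_0_if_span[OF alt, of y ?U "v # ?W"]
      multilinear_alternating_eq_0_if_span[OF alt, of "\<i> *s y" "?U @ [v]" ?W] y'
    by (auto intro: span_mono[THEN subsetD, rotated])
  note add = linear_add[OF multilinear_alternatingD(1)[OF alt]]
  note scale = linear_scale[OF multilinear_alternatingD(1)[OF alt]]
  have add1: "\<alpha> (?U @ (a + b) # v # ?W) = \<alpha> (?U @ a # v # ?W) + \<alpha> (?U @ b # v # ?W)"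
    and add2: "\<alpha> (?U @ v # (a + b) # ?W) = \<alpha> (?U @ v # a # ?W) + \<alpha> (?U @ v # b # ?W)"
    and scale1: "\<alpha> (?U @ (r *\<^sub>R a) # v # ?W) = r *\<^sub>R \<alpha> (?U @ a # v # ?W)"
    and scale2: "\<alpha> (?U @ v # (r *\<^sub>R a) # ?W) = r *\<^sub>R \<alpha> (?U @ v # a # ?W)" for a b v r
    using add[of ?U a b "v # ?W"] add[of "?U @ [v]" a b ?W]
      scale[of ?U r a "v # ?W"] scale[of "?U @ [v]" r a ?W] by simp_all
  let ?B = "\<lambda>p q. \<alpha> (?U @ p # q # ?W)"
  have "?B (c *s u + y) (\<i> *s (c *s u + y)) = ?B (c *s u + y) (\<i> *s (c *s u) + \<i> *s y)"
    by (simp add: vec.scale_right_distrib)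
  also have "\<dots> = ?B (c *s u) (\<i> *s (c *s u))"
    by (simp only: add1 add2 0 add_0_right)
  \<comment> \<open>In terms of \<open>u\<close> and \<open>\<i> *s u\<close> the two arguments have
    coefficient rows \<open>(Re c, Im c)\<close> and \<open>(- Im c, Re c)\<close>; alternation then
    produces the determinant.\<close>
  also have "\<dots> = ?B (Re c *\<^sub>R u + Im c *\<^sub>R (\<i> *s u)) (- Im c *\<^sub>R u + Re c *\<^sub>R (\<i> *s u))"
  proof -
    have "c *s u = Re c *\<^sub>R u + Im c *\<^sub>R (\<i> *s u)"
      "\<i> *s (c *s u) = - Im c *\<^sub>R u + Re c *\<^sub>R (\<i> *s u)"
      by (simp_all add: vec_eq_iff complex_eq_iff)
    then show ?thesis by metis
  qed
  also have "\<dots> = complex_of_real ((cmod c)\<^sup>2) * ?B u (\<i> *s u)"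
    unfolding add1 add2 scale1 scale2 multilinear_alternatingD(2)[OF alt]
      multilinear_alternating_swap[OF alt, of ?U "\<i> *s u" u]
    by (simp add: cmod_power2 complex_scaleR algebra_simps) (simp add: power2_eq_square)
  finally show ?thesis by simp
qed

text \<open>Coefficients are indexed by \<open>I\<close> rather than by vectors, so that
  \<open>V\<close> may take a value twice.\<close>

lemma in_vec_span_image:
  assumes "finite I" "x \<in> vec.span (V ` I)"
  shows "\<exists>a. x = (\<Sum>i\<in>I. a i *s V i)"
  using assms
proof (induction I arbitrary: x)
  case (insert i I)
  then obtain k where "x - k *s V i \<in> vec.span (V ` I)"
    by (auto simp: vec.span_breakdown_eq)
  with insert.IH obtain a where a: "x - k *s V i = (\<Sum>i\<in>I. a i *s V i)" by blast
  have "(\<Sum>j\<in>I. (a(i := k)) j *s V j) = (\<Sum>j\<in>I. a j *s V j)"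
    using insert.hyps by (intro sum.cong) auto
  then have "x = (\<Sum>j\<in>insert i I. (a(i := k)) j *s V j)"
    using a insert.hyps by (simp add: algebra_simps)
  then show ?case by blast
qed simp

text \<open>A Steinitz exchange replaces the vectors of \<open>V\<close> by those of \<open>W\<close> one at a time. By
  \<open>frame_update\<close>, every step multiplies the value by the square of a modulus.\<close>

lemma frame_exchange:
  fixes V W :: "'n::finite \<Rightarrow> complex^'n" and ks :: "'n list"
  assumes alt: "multilinear_alternating \<alpha>" and "finite J" and "distinct ks" "set ks = UNIV"
    and "vec.span (range V) = UNIV" "\<And>i. i \<notin> J \<Longrightarrow> V i = W i"
  shows "\<exists>c\<ge>0. \<alpha> (real_frame (map W ks)) = complex_of_real c * \<alpha> (real_frame (map V ks))"
  using assms(2,5,6)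
proof (induction J arbitrary: V)
  case empty
  then have "V = W" by auto
  then show ?case by (intro exI[of _ 1]) auto
next
  case (insert j J)
  define F where "F V = \<alpha> (real_frame (map V ks))" for V
  have upd: "F (V(j := c *s V j + y)) = complex_of_real ((cmod c)\<^sup>2) * F V"
    if "y \<in> vec.span (V ` (- {j}))" for V j c y
  proof -
    obtain ps qs where ks: "ks = ps @ j # qs"
      using \<open>set ks = UNIV\<close> by (metis UNIV_I split_list)
    have j: "j \<notin> set ps" "j \<notin> set qs" "set ps \<union> set qs = - {j}"
      using assms(3,4) by (auto simp: ks)
    then have m: "map (V(j := w)) ks = map V ps @ w # map V qs" for w
      by (simp add: ks map_fun_upd)
    have "V ` (- {j}) = set (map V ps) \<union> set (map V qs)" using j(3) by (auto simp flip: image_Un)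
    then show ?thesis
      using frame_update[OF alt, of y "map V ps" "map V qs" c "V j"] that m[of "V j"]
      unfolding F_def m by (simp add: ks)
  qed
  show ?case
  proof (cases "W j \<in> vec.span (W ` (- {j}))")
    case True
    \<comment> \<open>The update leaves \<open>W\<close> as it is, but the coefficient
      \<open>0\<close> forces its value to vanish. A dependent target frame thus gets the ratio
      \<open>0\<close>.\<close>
    have "F (W(j := 0 *s W j + W j)) = complex_of_real ((cmod 0)\<^sup>2) * F W"
      by (rule upd[OF True])
    then show ?thesis by (intro exI[of _ 0]) (simp add: F_def)
  next
    case False
    obtain a where a: "W j = (\<Sum>i\<in>UNIV. a i *s V i)"
      using in_vec_span_image[of UNIV "W j" V] insert.prems(1) by auto
    \<comment> \<open>Some index still to be exchanged must occur in \<open>W j\<close>; otherwise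
      \<open>W j\<close> would lie in the span of the other \<open>W i\<close>, the case just
      settled.\<close>
    obtain k where k: "k \<in> insert j J" "a k \<noteq> 0"
    proof (rule ccontr)
      assume "\<not> thesis"
      with that have "W j = (\<Sum>i\<in>- insert j J. a i *s V i)"
        unfolding a by (intro sum.mono_neutral_right) auto
      also have "\<dots> = (\<Sum>i\<in>- insert j J. a i *s W i)"
        using insert.prems(2) by (intro sum.cong) auto
      also have "\<dots> \<in> vec.span (W ` (- {j}))"
        by (intro vec.span_sum vec.span_scale vec.span_base) auto
      finally show False using False by blast
    qed
    \<comment> \<open>The swap puts a nonzero coefficient at \<open>j\<close>. It is composed of
      three updates with coefficients \<open>1\<close>, \<open>-1\<close> and \<open>1\<close>, all
      of modulus one, so \<open>F\<close> does not change.\<close>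
    define V' where "V' = V \<circ> Transposition.transpose j k"
    have F': "F V' = F V"
    proof (cases "k = j")
      case False
      define V1 where "V1 = V(j := 1 *s V j + V k)"
      define V2 where "V2 = V1(k := (-1) *s V1 k + V1 j)"
      have "V' = V2(j := 1 *s V2 j + (-1) *s V2 k)"
        using False by (auto simp: V'_def V1_def V2_def fun_eq_iff Transposition.transpose_def)
      moreover have "(-1) *s V2 k \<in> vec.span (V2 ` (- {j}))"
        by (intro vec.span_scale vec.span_base) (use False in auto)
      ultimately have "F V' = F V2" using upd[of "(-1) *s V2 k" V2 j 1] by simp
      also have "V1 j \<in> vec.span (V1 ` (- {k}))"
        by (rule vec.span_base) (use False in auto)
      then have "F V2 = F V1" unfolding V2_def using upd[of "V1 j" V1 k "-1"] by simp
      also have "V k \<in> vec.span (V ` (- {j}))"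
        by (rule vec.span_base) (use False in auto)
      then have "F V1 = F V" unfolding V1_def using upd[of "V k" V j 1] by simp
      finally show ?thesis .
    qed (simp add: V'_def)
    define a' where "a' = a \<circ> Transposition.transpose j k"
    have "W j = (\<Sum>i\<in>UNIV. a' i *s V' i)"
      unfolding a a'_def V'_def comp_def
      by (rule sum.reindex_bij_betw[symmetric]) simp
    also have "\<dots> = a' j *s V' j + (\<Sum>i\<in>-{j}. a' i *s V' i)"
      by (simp add: sum.remove[of UNIV j] Compl_eq_Diff_UNIV)
    finally have Wj: "W j = a' j *s V' j + (\<Sum>i\<in>-{j}. a' i *s V' i)" .
    have a'j: "a' j \<noteq> 0" using k by (simp add: a'_def)
    have y: "(\<Sum>i\<in>-{j}. a' i *s V' i) \<in> vec.span (V' ` (- {j}))"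
      by (intro vec.span_sum vec.span_scale vec.span_base) auto
    define V'' where "V'' = V'(j := W j)"
    have F'': "F V'' = complex_of_real ((cmod (a' j))\<^sup>2) * F V"
      using upd[OF y, of "a' j"] unfolding V''_def Wj[symmetric] F' .
    have "range V' = range V" unfolding V'_def
      by (metis bij_transpose bij_is_surj image_comp)
    have im: "V'' ` (- {j}) = V' ` (- {j})" by (auto simp: V''_def)
    \<comment> \<open>As \<open>a' j\<close> is nonzero, the displaced vector is recovered from
      \<open>W j\<close> and the others, so the new family still spans.\<close>
    have "V' j \<in> vec.span (range V'')"
    proof -
      have V'j: "V' j = inverse (a' j) *s (W j - (\<Sum>i\<in>-{j}. a' i *s V' i))"
        using a'j by (simp add: Wj)
      have "W j \<in> vec.span (range V'')"
        by (metis V''_def fun_upd_same rangeI vec.span_base)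
      moreover have "(\<Sum>i\<in>-{j}. a' i *s V' i) \<in> vec.span (range V'')"
        using y im vec.span_mono[of "V'' ` (- {j})" "range V''"] by auto
      ultimately show ?thesis
        unfolding V'j by (intro vec.span_scale vec.span_diff)
    qed
    moreover have "V' i \<in> vec.span (range V'')" if "i \<noteq> j" for i
      using that by (metis V''_def fun_upd_other rangeI vec.span_base)
    ultimately have "range V' \<subseteq> vec.span (range V'')" by (metis image_subsetI)
    then have "vec.span (range V'') = UNIV"
      using \<open>range V' = range V\<close> insert.prems(1) by (metis top.extremum_uniqueI vec.span_minimal vec.subspace_span)
    moreover have "V'' i = W i" if "i \<notin> J" for i
    proof (cases "i = j")
      case False
      \<comment> \<open>Both \<open>j\<close> and \<open>k\<close> lie in \<open>insert j J\<close>,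
        so the swap fixes every index outside it.\<close>
      with that k(1) have "i \<notin> insert j J" "Transposition.transpose j k i = i"
        by (auto simp: Transposition.transpose_def)
      then show ?thesis using False insert.prems(2) by (simp add: V''_def V'_def)
    qed (simp add: V''_def)
    ultimately obtain c where "c \<ge> 0" "F W = complex_of_real c * F V''"
      using insert.IH[of V''] unfolding F_def by blast
    then show ?thesis unfolding F_def[symmetric] F''
      by (intro exI[of _ "c * (cmod (a' j))\<^sup>2"]) simp
  qed
qed

text \<open>The lists are read as families indexed by the type \<open>'n\<close>, as
  \<open>frame_exchange\<close> requires. Only \<open>us\<close> has to be a basis;
  \<open>ws\<close> may be dependent, and \<open>c\<close> may be \<open>0\<close>.\<close>

lemma frame_ratio_nonneg:
  fixes us ws :: "(complex^'n::finite) list"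
  assumes "multilinear_alternating \<alpha>" "complex_basis us" "length ws = CARD('n)"
  shows "\<exists>c\<ge>0. \<alpha> (real_frame ws) = complex_of_real c * \<alpha> (real_frame us)"
proof -
  obtain ks :: "'n list" where ks: "distinct ks" "set ks = UNIV"
    using finite_distinct_list[of "UNIV :: 'n set"] by auto
  then have len: "length ks = CARD('n)" by (metis distinct_card)
  have ex: "\<exists>V. map V ks = vs" if "length vs = CARD('n)" for vs :: "(complex^'n) list"
  proof
    show "map (the \<circ> map_of (zip ks vs)) ks = vs"
      by (rule nth_equalityI) (use that len ks in \<open>auto simp: map_of_zip_nth\<close>)
  qed
  obtain V W where V: "map V ks = us" and W: "map W ks = ws"
    using ex[of us] ex[of ws] assms by (auto simp: complex_basis_def)
  have "range V = set us" using V ks by (metis set_map)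
  moreover have "vec.span (set us) = UNIV"
  proof -
    have "card (set us) = CARD('n)" "vec.independent (set us)"
      using assms(2) by (auto simp: complex_basis_def distinct_card)
    then show ?thesis
      using vec.card_ge_dim_independent[of "set us" UNIV] by (auto simp: card_cart_basis)
  qed
  ultimately show ?thesis
    using frame_exchange[OF assms(1), of UNIV ks V W] ks V W by auto
qed

text \<open>The ratio leads from an arbitrary basis \<open>us\<close> to \<open>ws\<close>. It
  cannot be \<open>0\<close> because the value on \<open>ws\<close> is positive, so it can be
  inverted.\<close>

lemma positive_volume_if_positive_on_frame:
  fixes \<eta> :: "'n::finite kform"
  assumes "alternating_form (2 * CARD('n)) \<eta>" "length ws = CARD('n)"
    "positive_complex (\<eta> (real_frame ws))"
  shows "positive_volume \<eta>"
  unfolding positive_volume_def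
proof (intro conjI allI impI)
  fix us :: "(complex^'n) list" assume "complex_basis us"
  then obtain c where c: "c \<ge> 0" "\<eta> (real_frame ws) = complex_of_real c * \<eta> (real_frame us)"
    using frame_ratio_nonneg assms(1,2) by (metis alternating_form_iff)
  obtain r where r: "\<eta> (real_frame ws) = complex_of_real r" "r > 0"
    using assms(3) by (auto simp: positive_complex_def elim!: Reals_cases)
  with c have "c > 0" by (cases "c = 0") auto
  then have "\<eta> (real_frame us) = complex_of_real (r / c)"
    using c(2) r(1) by (simp add: field_simps)
  then show "positive_complex (\<eta> (real_frame us))"
    using \<open>r > 0\<close> \<open>c > 0\<close> by (simp add: positive_complex_def)
qed (fact assms(1))

section \<open>Evaluation of the Hodge star\<close>

lemma one_form0_wedge: "one_form0 \<and>\<^sub>f \<beta> = \<beta>"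
proof
  fix vs show "(one_form0 \<and>\<^sub>f \<beta>) vs = \<beta> vs"
  proof (induction vs arbitrary: \<beta>)
    case (Cons v vs)
    have "contract v one_form0 = (\<lambda>_. 0)" "grade_sign one_form0 = (one_form0 :: 'a kform)"
      by (auto simp: contract_def grade_sign_def one_form0_def)
    then show ?case by (simp add: wedge_Cons wedge_zero_left Cons.IH contract_apply)
  qed (simp add: wedge_Nil one_form0_def)
qed

lemma contract_covector: "contract v (covector a) = (\<lambda>vs. a v * one_form0 vs)"
  by (auto simp: contract_def covector_def one_form0_def)

lemma contract_wedge_list_eq_0:
  assumes "\<And>a. a \<in> set as \<Longrightarrow> a v = 0"
  shows "contract v (wedge_list (map covector as)) = (\<lambda>_. 0)"
  using assms
proof (induction as)
  case (Cons a as)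
  moreover have "contract v (covector a) = (\<lambda>_. 0)"
    using Cons.prems[of a] by (simp add: contract_covector)
  ultimately show ?case
    by (simp add: wedge_list_Cons contract_wedge wedge_zero_left wedge_zero_right)
qed (simp add: wedge_list_Nil contract_def one_form0_def)

text \<open>This is the determinant of the identity matrix. All later covectors kill the first
  vector, so only the first covector can receive it.\<close>

lemma wedge_list_dual_frame:
  assumes "length as = length es"
    "\<And>i j. i < length es \<Longrightarrow> j < length es \<Longrightarrow> (as ! i) (es ! j) = (if i = j then 1 else 0)"
  shows "wedge_list (map covector as) es = 1"
  using assms
proof (induction as es rule: list_induct2)
  case (Cons a as e es)
  have "a' e = 0" if a': "a' \<in> set as" for a'
  proof -
    obtain i where "i < length as" "a' = as ! i" using a' by (metis in_set_conv_nth)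
    then show ?thesis using Cons.prems[of "Suc i" 0] Cons.hyps by simp
  qed
  then have "contract e (wedge_list (map covector as)) = (\<lambda>_. 0)"
    by (rule contract_wedge_list_eq_0)
  moreover have "a e = 1" using Cons.prems[of 0 0] by simp
  moreover have "wedge_list (map covector as) es = 1"
  proof (rule Cons.IH)
    fix i j assume "i < length es" "j < length es"
    then show "(as ! i) (es ! j) = (if i = j then 1 else 0)"
      using Cons.prems[of "Suc i" "Suc j"] by simp
  qed
  ultimately show ?case
    by (simp add: wedge_list_Cons wedge_Cons contract_covector wedge_zero_right one_form0_wedge)
qed (simp add: wedge_list_Nil one_form0_def)

lemma linear_riemannian:
  assumes "alternating_form 2 G"
  shows "linear (riemannian G v)" "linear (\<lambda>v. riemannian G v w)"
proof -
  note lin = multilinear_alternatingD(1)[of G "[v]" "[]"] multilinear_alternatingD(1)[of G "[]" "[\<i> *s w]"]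
  have "linear (\<lambda>w. \<i> *s w :: complex^'a)"
    by (rule linearI) (simp_all add: vec_eq_iff complex_scaleR algebra_simps)
  then show "linear (riemannian G v)" "linear (\<lambda>v. riemannian G v w)"
    using assms lin unfolding riemannian_def alternating_form_iff
    by (auto intro!: linear_compose[OF _ bounded_linear.linear[OF bounded_linear_Re], unfolded comp_def]
        linear_compose[of "\<lambda>w. \<i> *s w" "\<lambda>w. G [v, w]", unfolded comp_def])
qed

text \<open>Only the full index set contributes, because \<open>volume_form G\<close> vanishes on
  shorter lists, and on the whole frame it equals \<open>1\<close> by orthonormality. The hypothesis
  on \<open>us\<close> ensures that \<open>SOME\<close> picks a genuine unitary basis.\<close>

lemma hodge_star_top:
  fixes G :: "'n::finite kform"
  assumes "alternating_form 2 G" "unitary_basis G us"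
  shows "hodge_star G \<beta> [] = \<beta> (orthonormal_frame G)"
proof -
  define e where "e = orthonormal_frame G"
  define ws where "ws = (SOME us. unitary_basis G us)"
  have "unitary_basis G ws" unfolding ws_def using assms(2) by (rule someI)
  moreover have "e = real_frame ws" by (simp add: e_def ws_def orthonormal_frame_def)
  ultimately have len: "length e = 2 * CARD('n)"
    and e: "\<And>i j. i < length e \<Longrightarrow> j < length e \<Longrightarrow>
      riemannian G (e ! i) (e ! j) = (if i = j then 1 else 0)"
    by (auto simp: unitary_basis_def length_real_frame Let_def)
  define as where "as = map (\<lambda>e v. complex_of_real (riemannian G e v)) e"
  have vol: "volume_form G = wedge_list (map covector as)"
    by (simp add: volume_form_def as_def e_def comp_def)
  have vol1: "volume_form G e = 1"
    unfolding vol by (rule wedge_list_dual_frame) (auto simp: as_def e)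
  have "linear (\<lambda>v. complex_of_real (riemannian G w v))" for w
    using linear_compose[OF linear_riemannian(1)[OF assms(1)] bounded_linear.linear[OF bounded_linear_of_real]]
    by (simp add: comp_def)
  then have "alternating_form (length as) (volume_form G)"
    unfolding vol by (intro alternating_form_wedge_list) (auto simp: as_def)
  then have vol0: "volume_form G vs = 0" if "length vs \<noteq> length e" for vs
    using that by (simp add: alternating_form_def as_def)
  have "hodge_star G \<beta> [] = (\<Sum>I\<in>Pow {..<length e}. \<beta> (nths e I) * volume_form G (nths e I))"
    by (simp add: hodge_star_def e_def Let_def)
  also have "\<dots> = (\<Sum>I\<in>{{..<length e}}. \<beta> (nths e I) * volume_form G (nths e I))"
  proof (rule sum.mono_neutral_right)
    show "\<forall>I\<in>Pow {..<length e} - {{..<length e}}. \<beta> (nths e I) * volume_form G (nths e I) = 0"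
    proof
      fix I assume "I \<in> Pow {..<length e} - {{..<length e}}"
      then have "I \<subset> {..<length e}" "{i. i < length e \<and> i \<in> I} = I" by auto
      then have "length (nths e I) \<noteq> length e"
        using psubset_card_mono[of "{..<length e}" I] by (simp add: length_nths)
      then show "\<beta> (nths e I) * volume_form G (nths e I) = 0" by (simp add: vol0)
    qed
  qed auto
  also have "\<dots> = \<beta> e" by (simp add: vol1)
  finally show ?thesis by (simp add: e_def)
qed

section \<open>Existence of unitary bases\<close>

text \<open>On a monomial, the factor \<open>\<i>\<close> from the covector of type (1, 0) meets
  \<open>- \<i>\<close> from the conjugate one. This invariance makes \<open>riemannian G\<close>
  symmetric.\<close>

lemma Lambda_1_1_rotate:
  assumes "G \<in> Lambda 1 1"
  shows "G [\<i> *s v, \<i> *s w] = G [v, w]"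
  using assms
proof (induction rule: Lambda.induct)
  case (monomial as bs)
  then obtain a b where ab: "as = [a]" "bs = [b]" by (auto simp: length_Suc_conv)
  have "a (\<i> *s x) = \<i> * a x" "b (\<i> *s x) = \<i> * b x" for x
    using monomial unfolding ab complex_functional_def
    by (auto simp: Vector_Spaces.linear_iff)
  moreover have "\<i> * x * (\<i> * y) = - (x * y)" for x y
    by (simp add: complex_eq_iff algebra_simps)
  ultimately show ?case
    by (simp add: ab wedge_list_Cons wedge_list_Nil wedge_Cons wedge_Nil contract_def covector_def
        cnj_form_def grade_sign_def one_form0_def)
qed auto

text \<open>Gram-Schmidt over the reals, where each new unit vector \<open>u\<close> brings
  \<open>\<i> *s u\<close> along. Invariance under multiplication by \<open>\<i>\<close> keeps the
  enlarged frame orthonormal.\<close>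

lemma unitary_basis_exists:
  fixes G :: "'n::finite kform"
  assumes alt: "alternating_form 2 G" and G11: "G \<in> Lambda 1 1"
    and pos: "\<And>v. v \<noteq> 0 \<Longrightarrow> positive_complex (G [v, \<i> *s v])"
  shows "\<exists>us. unitary_basis G us"
proof -
  let ?g = "riemannian G"
  note lin1 = linear_riemannian(1)[OF alt] and lin2 = linear_riemannian(2)[OF alt]
  have ma: "multilinear_alternating G" using alt by (simp add: alternating_form_iff)
  have neg: "\<i> *s (\<i> *s v) = - v" for v :: "complex^'n"
    by (simp add: vec_eq_iff)
  have sym: "?g v w = ?g w v" for v w
  proof -
    have "G [v, \<i> *s w] = G [\<i> *s v, - w]"
      using Lambda_1_1_rotate[OF G11, of v "\<i> *s w"] by (simp only: neg)
    also have "\<dots> = - G [\<i> *s v, w]"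
      using linear_neg[OF multilinear_alternatingD(1)[OF ma, of "[\<i> *s v]" "[]"], of w] by simp
    also have "\<dots> = G [w, \<i> *s v]"
      using multilinear_alternating_swap[OF ma, of "[]" w "\<i> *s v" "[]"] by simp
    finally show ?thesis by (simp add: riemannian_def)
  qed
  have rot: "?g (\<i> *s v) (\<i> *s w) = ?g v w" for v w
    unfolding riemannian_def using Lambda_1_1_rotate[OF G11, of v "\<i> *s w"] by simp
  have rot': "?g v (\<i> *s w) = - ?g (\<i> *s v) w" for v w
    using rot[of v "\<i> *s w"] linear_neg[OF lin1, of "\<i> *s v" w] by (simp add: neg)
  have "\<exists>us. length us = k \<and> (\<forall>i<2 * k. \<forall>j<2 * k.
      ?g (real_frame us ! i) (real_frame us ! j) = (if i = j then 1 else 0))" if "k \<le> CARD('n)" for k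
    using that
  proof (induction k)
    case (Suc k)
    then obtain us where us: "length us = k" and
      orth: "\<And>i j. i < 2 * k \<Longrightarrow> j < 2 * k \<Longrightarrow>
        ?g (real_frame us ! i) (real_frame us ! j) = (if i = j then 1 else 0)"
      by auto
    define e where "e = real_frame us"
    have le: "length e = 2 * k" by (simp add: e_def length_real_frame us)
    \<comment> \<open>At most \<open>2 * k\<close> vectors cannot span a real space of dimension
      \<open>2 * CARD('n)\<close>, so some \<open>x\<close> lies outside their span.\<close>
    have "dim (set e) \<le> card (set e)" by (intro dim_le_card) (auto intro: span_base)
    also have "\<dots> \<le> 2 * k" using card_length[of e] le by simp
    also have "\<dots> < DIM(complex^'n)" using Suc.prems by simp
    finally have "span (set e) \<noteq> UNIV" using dim_span[of "set e"] by (metis dim_UNIV less_irrefl)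
    then obtain x where x: "x \<notin> span (set e)" by auto
    \<comment> \<open>This subtracts from \<open>x\<close> its orthogonal projection to the span of
      \<open>e\<close>.\<close>
    define y where "y = x - (\<Sum>i<2 * k. ?g (e ! i) x *\<^sub>R (e ! i))"
    have "(\<Sum>i<2 * k. ?g (e ! i) x *\<^sub>R (e ! i)) \<in> span (set e)"
      by (intro span_sum span_scale span_base) (simp add: le)
    then have "y \<noteq> 0" using x by (auto simp: y_def)
    have orthy: "?g w y = 0" if w: "w \<in> set e" for w
    proof -
      obtain j where j: "j < 2 * k" "w = e ! j" using w by (metis in_set_conv_nth le)
      have "?g w y = ?g w x - (\<Sum>i<2 * k. ?g (e ! i) x * ?g w (e ! i))"
        by (simp add: y_def linear_diff[OF lin1] linear_sum[OF lin1] linear_scale[OF lin1])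
      also have "(\<Sum>i<2 * k. ?g (e ! i) x * ?g w (e ! i)) = (\<Sum>i<2 * k. if i = j then ?g w x else 0)"
        by (rule sum.cong) (auto simp: j orth e_def)
      finally show ?thesis using j by simp
    qed
    define r where "r = ?g y y"
    have "r > 0" using pos[OF \<open>y \<noteq> 0\<close>] by (simp add: r_def riemannian_def positive_complex_def)
    define u where "u = (1 / sqrt r) *\<^sub>R y"
    have guu: "?g u u = 1"
      using \<open>r > 0\<close> by (simp add: u_def linear_scale[OF lin1] linear_scale[OF lin2] flip: r_def)
    have orthu: "?g w u = 0" if "w \<in> set e" for w
      using orthy[OF that] by (simp add: u_def linear_scale[OF lin1])
    have orthiu: "?g w (\<i> *s u) = 0" if w: "w \<in> set e" for w
    proof -
      \<comment> \<open>Up to sign the frame is stable under multiplication by \<open>\<i>\<close>,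
        so the claim for \<open>w\<close> follows from orthogonality of \<open>u\<close> to the
        partner of \<open>w\<close>.\<close>
      consider "w \<in> set us" | u' where "u' \<in> set us" "w = \<i> *s u'"
        using w unfolding e_def set_real_frame by blast
      then show ?thesis
      proof cases
        case 1
        then have "\<i> *s w \<in> set e" by (simp add: e_def set_real_frame)
        then show ?thesis using orthu by (simp add: rot')
      next
        case 2
        then have "u' \<in> set e" by (simp add: e_def set_real_frame)
        then show ?thesis using orthu 2(2) by (simp add: rot)
      qed
    qed
    have giu: "?g u (\<i> *s u) = 0" "?g (\<i> *s u) (\<i> *s u) = 1"
      using rot'[of u u] sym[of "\<i> *s u" u] rot[of u u] guu by simp_all
    have fr: "real_frame (us @ [u]) = e @ [u, \<i> *s u]" by (simp add: e_def)
    have mem: "e ! i \<in> set e" if "i < 2 * k" for i using that le by simp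
    have prods: "?g (e ! i) (e ! j) = (if i = j then 1 else 0)"
      "?g (e ! i) u = 0" "?g u (e ! i) = 0" "?g (e ! i) (\<i> *s u) = 0" "?g (\<i> *s u) (e ! i) = 0"
      if "i < 2 * k" "j < 2 * k" for i j
      using orth[OF that] orthu[OF mem[OF that(1)]] orthiu[OF mem[OF that(1)]] sym[of u "e ! i"]
        sym[of "\<i> *s u" "e ! i"] by (simp_all add: e_def)
    have giu': "?g (\<i> *s u) u = 0" using giu(1) sym by simp
    show ?case
    proof (intro exI[of _ "us @ [u]"] conjI allI impI)
      fix i j assume "i < 2 * Suc k" "j < 2 * Suc k"
      then have "i < 2 * k \<or> i = 2 * k \<or> i = Suc (2 * k)" "j < 2 * k \<or> j = 2 * k \<or> j = Suc (2 * k)"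
        by (auto simp: less_Suc_eq)
      then show "?g (real_frame (us @ [u]) ! i) (real_frame (us @ [u]) ! j)
          = (if i = j then 1 else 0)"
        unfolding fr by (elim disjE) (simp_all add: nth_append le prods guu giu giu')
    qed (simp add: us)
  qed simp
  then obtain us where "length us = CARD('n)" "\<forall>i<2 * CARD('n). \<forall>j<2 * CARD('n).
      ?g (real_frame us ! i) (real_frame us ! j) = (if i = j then 1 else 0)" by blast
  then show ?thesis by (auto simp: unitary_basis_def length_real_frame)
qed

section \<open>Positivity\<close>

lemma decomposable_Lambda: "decomposable p \<subseteq> Lambda p 0"
proof
  fix \<psi> :: "'n::finite kform" assume "\<psi> \<in> decomposable p"
  then obtain as where "length as = p" "\<forall>a\<in>set as. complex_functional a"
    "\<psi> = wedge_list (map covector as)"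
    by (auto simp: decomposable_def)
  then show "\<psi> \<in> Lambda p 0" using Lambda.monomial[of as p "[]" 0] by simp
qed

text \<open>In bidegree \<open>(2, 0)\<close> the Lefschetz image vanishes, so every form is primitive and the
  Hodge-Riemann relation is an inequality for all forms.\<close>

lemma HR_form_at_2_0_positive:
  fixes \<Omega> :: "'n::finite kform"
  assumes n: "CARD('n) \<ge> 2" and alt: "alternating_form (2 * (CARD('n) - 2)) \<Omega>"
    and HR: "HR_form_at G \<omega> \<Omega> 2 0"
    and G: "alternating_form 2 G" "unitary_basis G us"
    and \<psi>: "\<psi> \<in> decomposable 2" "\<psi> \<noteq> (\<lambda>_. 0)"
  shows "positive_volume (\<Omega> \<and>\<^sub>f \<psi> \<and>\<^sub>f cnj_form \<psi>)"
proof -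
  have \<psi>20: "\<psi> \<in> Lambda 2 0" using \<psi>(1) decomposable_Lambda by blast
  have "Lambda 2 0 = primitive_forms \<omega> \<Omega> 2 0"
    using HR unfolding HR_form_at_def lefschetz_image_def by auto
  then have "positive_complex (HR_pairing G \<Omega> 2 0 \<psi> \<psi>)"
    using HR \<psi>20 \<psi>(2) unfolding HR_form_at_def by blast
  \<comment> \<open>This sign cancels the one in front of the pairing, so the value of the star
    itself is positive.\<close>
  moreover have "\<i> powi (int 2 - int 0) = -1" by simp
  ultimately have "positive_complex ((\<psi> \<and>\<^sub>f cnj_form \<psi> \<and>\<^sub>f \<Omega>) (orthonormal_frame G))"
    unfolding HR_pairing_def hodge_star_top[OF G] by simp
  moreover have "\<psi> \<and>\<^sub>f cnj_form \<psi> \<and>\<^sub>f \<Omega> = \<Omega> \<and>\<^sub>f \<psi> \<and>\<^sub>f cnj_form \<psi>"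
  proof -
    \<comment> \<open>Having even degree, \<open>\<Omega>\<close> moves to the front without a
      sign.\<close>
    have "grade_sign \<Omega> = \<Omega>" using grade_sign_even[OF alt] by simp
    from wedge_commute_even[OF this, of "\<psi> \<and>\<^sub>f cnj_form \<psi>"] show ?thesis by (simp add: wedge_assoc)
  qed
  moreover have "alternating_form (2 * CARD('n)) (\<Omega> \<and>\<^sub>f \<psi> \<and>\<^sub>f cnj_form \<psi>)"
  proof -
    note \<psi>2 = alternating_form_decomposable[OF \<psi>(1)]
    have "2 * (CARD('n) - 2) + (2 + 2) = 2 * CARD('n)" using n by simp
    then show ?thesis
      using alternating_form_wedge[OF alt alternating_form_wedge[OF \<psi>2 alternating_form_cnj[OF \<psi>2]]]
      by simp
  qed
  moreover have "unitary_basis G (SOME us. unitary_basis G us)" using G(2) by (rule someI)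
  then have "length (SOME us. unitary_basis G us) = CARD('n)" by (simp add: unitary_basis_def)
  ultimately show ?thesis
    by (intro positive_volume_if_positive_on_frame) (auto simp: orthonormal_frame_def)
qed

text \<open>Extend \<open>v\<close> to a basis and take the coordinate functionals of the two new
  vectors.\<close>

lemma dual_functionals_exist:
  fixes v :: "complex^'n::finite"
  assumes "CARD('n) = 3" "v \<noteq> 0"
  obtains u w a b where "complex_basis [v, u, w]" "complex_functional a" "complex_functional b"
    "a v = 0" "a u = 1" "a w = 0" "b v = 0" "b u = 0" "b w = 1"
proof -
  interpret p: vector_space_pair "(*s) :: complex \<Rightarrow> complex^'n \<Rightarrow> complex^'n" "(*) :: complex \<Rightarrow> complex \<Rightarrow> complex"
    by unfold_locales
  define B where "B = vec.extend_basis {v}"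
  have ind: "vec.independent {v}" using assms(2) by simp
  have B: "v \<in> B" "vec.independent B" "vec.span B = UNIV"
    unfolding B_def using vec.extend_basis_superset[OF ind] vec.independent_extend_basis[OF ind]
      vec.span_extend_basis[OF ind] by auto
  have "card B = 3" using vec.dim_span_eq_card_independent[OF B(2)] assms(1) by (simp add: B(3) card_cart_basis)
  then have "card (B - {v}) = 2" using B(1) by simp
  then obtain u w where uw: "B - {v} = {u, w}" "u \<noteq> w" by (auto simp: card_2_iff)
  then have B': "B = {v, u, w}" "u \<noteq> v" "w \<noteq> v" using B(1) by auto
  define f where "f x = p.construct B (\<lambda>y. if y = x then 1 else 0)" for x
  have f: "complex_functional (f x)" "y \<in> B \<Longrightarrow> f x y = (if y = x then 1 else 0)" for x y
    unfolding f_def complex_functional_def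
    using p.linear_construct[OF B(2)] p.construct_basis[OF B(2)] by auto
  have "complex_basis [v, u, w]"
    using B(2) B' uw(2) assms(1) by (simp add: complex_basis_def)
  then show thesis
    using that[of u w "f u" "f w"] f B' uw(2) by auto
qed

text \<open>For \<open>n = 3\<close>, a \<open>(2, 0)\<close>-form \<open>\<psi>\<close> whose factors both vanish on \<open>v\<close> isolates the value
  of \<open>\<Omega>\<close> on the complex line spanned by \<open>v\<close>.\<close>

lemma positive_on_lines:
  fixes \<Omega> :: "'n::finite kform"
  assumes n: "CARD('n) = 3" and alt: "alternating_form 2 \<Omega>"
    and pos: "\<And>\<psi>. \<psi> \<in> decomposable 2 \<Longrightarrow> \<psi> \<noteq> (\<lambda>_. 0) \<Longrightarrow> positive_volume (\<Omega> \<and>\<^sub>f \<psi> \<and>\<^sub>f cnj_form \<psi>)"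
    and v: "v \<noteq> 0"
  shows "positive_complex (\<Omega> [v, \<i> *s v])"
proof -
  obtain u w a b where basis: "complex_basis [v, u, w]"
    and cf: "complex_functional a" "complex_functional b"
    and val: "a v = 0" "a u = 1" "a w = 0" "b v = 0" "b u = 0" "b w = 1"
    using dual_functionals_exist[OF n v] .
  have rot: "a (\<i> *s x) = \<i> * a x" "b (\<i> *s x) = \<i> * b x" for x
    using cf by (auto simp: complex_functional_def Vector_Spaces.linear_iff)
  define \<psi> where "\<psi> = wedge_list (map covector [a, b])"
  define \<zeta> where "\<zeta> = \<psi> \<and>\<^sub>f cnj_form \<psi>"
  have dec: "\<psi> \<in> decomposable 2"
    unfolding decomposable_def \<psi>_def using cf by (intro CollectI exI[of _ "[a, b]"]) simp
  have \<psi>2: "\<psi> [x, y] = a x * b y - a y * b x" for x y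
    by (simp add: \<psi>_def wedge_list_Cons wedge_list_Nil wedge_Cons wedge_Nil contract_def covector_def
        grade_sign_def one_form0_def)
  have \<psi>0: "\<psi> vs = 0" if "length vs \<noteq> 2" for vs
    using alternating_form_decomposable[OF dec] that by (simp add: alternating_form_def)
  have "\<psi> [u, w] \<noteq> 0" by (simp add: \<psi>2 val)
  then have "\<psi> \<noteq> (\<lambda>_. 0)" by auto
  then have "positive_complex ((\<Omega> \<and>\<^sub>f \<zeta>) (real_frame [v, u, w]))"
    using pos[OF dec] basis unfolding positive_volume_def \<zeta>_def by blast
  moreover have "(\<Omega> \<and>\<^sub>f \<zeta>) (real_frame [v, u, w]) = \<Omega> [v, \<i> *s v] * \<zeta> [u, \<i> *s u, w, \<i> *s w]"
  proof -
    \<comment> \<open>Both factors of \<open>\<psi>\<close> vanish on \<open>v\<close> and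
      \<open>\<i> *s v\<close>, so these two arguments must go to \<open>\<Omega>\<close>.\<close>
    have c\<zeta>: "contract x \<zeta> = (\<lambda>_. 0)" if "a x = 0" "b x = 0" for x
    proof -
      have "contract x \<psi> = (\<lambda>_. 0)"
        unfolding \<psi>_def by (rule contract_wedge_list_eq_0) (use that in auto)
      moreover from this have "contract x (cnj_form \<psi>) = (\<lambda>_. 0)"
        by (simp add: contract_def cnj_form_def fun_eq_iff)
      ultimately show ?thesis by (simp add: \<zeta>_def contract_wedge wedge_zero_left wedge_zero_right)
    qed
    have "contract (\<i> *s v) (contract v \<Omega>) = (\<lambda>vs. \<Omega> [v, \<i> *s v] * one_form0 vs)"
      using alt by (auto simp: contract_def one_form0_def alternating_form_def)
    then show ?thesis
      by (simp add: wedge_Cons[of _ _ v] wedge_Cons[of _ _ "\<i> *s v"] c\<zeta> val rot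
          wedge_zero_right wedge_scale_left one_form0_wedge)
  qed
  \<comment> \<open>The products of \<open>a\<close> and of \<open>b\<close> with their conjugates
    both have value \<open>- 2 * \<i>\<close> on their planes. Reordering the middle factors of
    \<open>\<zeta>\<close> costs a sign, which leaves minus the square of that value.\<close>
  moreover have "\<zeta> [u, \<i> *s u, w, \<i> *s w] = 4"
    unfolding \<zeta>_def
    by (simp add: wedge_Cons wedge_Nil contract_def grade_sign_def cnj_form_def \<psi>0 \<psi>2 val rot)
  ultimately show ?thesis by (simp add: positive_complex_def complex_is_Real_iff)
qed

theorem theorem1:
  fixes X :: "'m topology"
    and A :: "('m, 'n::finite) chart set"
    and g :: "('m, 'n) form"
  assumes "complex_manifold X A"
    and "CARD('n) \<ge> 3"
    and "hermitian_metric A g"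
    and "HR_balanced A g"
  shows "(\<exists>\<Theta>. p_kaehler_structure A (CARD('n) - 2) \<Theta>) \<and>
         (CARD('n) = 3 \<longrightarrow> kaehler_manifold A)"
proof -
  obtain \<omega> \<Omega> where \<Omega>: "pq_form A (CARD('n) - 2) (CARD('n) - 2) \<Omega>" "real_form A \<Omega>"
    and HR: "\<And>p q. p + q = 2 \<Longrightarrow> HR_form A g \<omega> \<Omega> p q" and closed: "closed_form A \<Omega>"
    using assms(4) by (auto simp: HR_balanced_def HR_type_def)
  have pos: "positive_volume (\<Omega> c z \<and>\<^sub>f \<psi> \<and>\<^sub>f cnj_form \<psi>)"
    if "c \<in> A" "z \<in> chart_image c" "\<psi> \<in> decomposable 2" "\<psi> \<noteq> (\<lambda>_. 0)" for c z \<psi>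
  proof -
    have G: "alternating_form 2 (g c z)" "g c z \<in> Lambda 1 1"
      "\<And>v. v \<noteq> 0 \<Longrightarrow> positive_complex (g c z [v, \<i> *s v])"
      using assms(3) that by (auto simp: hermitian_metric_def pq_form_def smooth_form_def numeral_2_eq_2)
    obtain us where us: "unitary_basis (g c z) us" using unitary_basis_exists[OF G] by blast
    have "alternating_form (2 * (CARD('n) - 2)) (\<Omega> c z)"
      using \<Omega>(1) that by (simp add: pq_form_def smooth_form_def mult_2)
    moreover have "HR_form_at (g c z) (\<omega> c z) (\<Omega> c z) 2 0"
      using HR[of 2 0] that by (simp add: HR_form_def)
    moreover have "CARD('n) \<ge> 2" using assms(2) by simp
    ultimately show ?thesis
      using HR_form_at_2_0_positive G(1) us that(3,4) by blast
  qed
  \<comment> \<open>The factor in \<open>transverse\<close> is therefore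
    \<open>\<i> ^ 4 = 1\<close>, and \<open>pos\<close> is exactly transversality.\<close>
  have "CARD('n) - (CARD('n) - 2) = 2" using assms(2) by simp
  then have "transverse A (CARD('n) - 2) \<Omega>"
    using pos by (simp add: transverse_def power_numeral_even)
  then have "p_kaehler_structure A (CARD('n) - 2) \<Omega>"
    using assms(2) \<Omega>(1) closed by (simp add: p_kaehler_structure_def)
  moreover have "kaehler_manifold A" if n: "CARD('n) = 3"
  proof -
    have "positive_complex (\<Omega> c z [v, \<i> *s v])"
      if "c \<in> A" "z \<in> chart_image c" "v \<noteq> 0" for c z v
    proof (rule positive_on_lines[OF n _ _ that(3)])
      show "alternating_form 2 (\<Omega> c z)"
        using \<Omega>(1) that by (simp add: pq_form_def smooth_form_def n numeral_2_eq_2)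
    qed (use pos that in auto)
    \<comment> \<open>Here \<open>CARD('n) - 2 = 1\<close>, so \<open>\<Omega>\<close> is a real
      form of type (1, 1), and positivity on complex lines makes it a metric.\<close>
    then show ?thesis
      using \<Omega> closed n by (auto simp: kaehler_manifold_def hermitian_metric_def)
  qed
  ultimately show ?thesis by blast
qed

end
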